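(* Let $\lambda$ be a positive integer, and let $(d,b)$ be an optimal solution of $\mathrm{DR}'(\lambda)$. Then there exists an optimal solution $(d^*,b^* )$ of $\mathrm{DR}'$ such that $$\|(d^*+b^* )-(d+b)\|_1<10\,\lambda\, n .$$
   Context: Let $n\ge 1$ and $N=\{1,\dots,n\}$. For $y\in\mathbb{R}^n$ and $X\subseteq N$ write $y(X)=\sum_{i\in X}y(i)$. Given are vectors $\bar d,\bar b\in\mathbb{Z}^n_+$ with $D=\bar d(N)$, $B=\bar b(N)$, a positive integer $\gamma$, integer vectors $\ell,u\in\mathbb{Z}^n$, and for each $i\in N$ a multimodular function $c_i:\mathbb{Z}^2_+\to\mathbb{R}$, meaning that for integers $\alpha,\beta$: (1) $c_i(\alpha+1,\beta+1)-c_i(\alpha+1,\beta)\ge c_i(\alpha,\beta+1)-c_i(\alpha,\beta)$ for $\alpha,\beta\ge 0$; (2) $c_i(\alpha-1,\beta+1)-c_i(\alpha-1,\beta)\ge c_i(\alpha,\beta)-c_i(\alpha,\beta-1)$ for $\alpha,\beta\ge 1$; (3) $c_i(\alpha+1,\beta-1)-c_i(\alpha,\beta-1)\ge c_i(\alpha,\beta)-c_i(\alpha-1,\beta)$ for $\alpha,\beta\ge1$. Problem $\mathrm{DR}$: minimize $c(d,b)=\sum_{i=1}^n c_i(d(i),b(i))$ over $d,b\in\mathbb{Z}^n_+$ subject to $d(N)+b(N)=D+B$, $b(N)\le B$, $\|(d+b)-(\bar d+\bar b)\|_1\le 2\gamma$, and $\ell\le d+b\le u$. Let $(d^\bullet,b^\bullet)$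 be an optimal solution of the relaxation of $\mathrm{DR}$ obtained by deleting the constraint $\|(d+b)-(\bar d+\bar b)\|_1\le 2\gamma$, chosen among the optimal solutions of the relaxation with minimum value of $\|(d+b)-(\bar d+\bar b)\|_1$. Standing assumption: $(d^\bullet,b^\bullet)$ violates the $\ell_1$-distance constraint, i.e. $\|(d^\bullet+b^\bullet)-(\bar d+\bar b)\|_1>2\gamma$. Put $P=\{i\in N: d^\bullet(i)+b^\bullet(i)>\bar d(i)+\bar b(i)\}$, $Q=N\setminus P$, $\xi_P=\bar d(P)+\bar b(P)+\gamma$, $\xi_Q=\bar d(Q)+\bar b(Q)-\gamma$. Let $\ell'(i)=\max\{\ell(i),\bar d(i)+\bar b(i)\}$ and $u'(i)=u(i)$ for $i\in P$; $\ell'(i)=\ell(i)$ and $u'(i)=\min\{u(i),\bar d(i)+\bar b(i)\}$ for $i\in Q$. Problem $\mathrm{DR}'$: minimize $c(d,b)$ over $d,b\in\mathbb{Z}^n_+$ subject to $d(N)+b(N)=D+B$, $b(N)\le B$, $d(P)+b(P)\le\xi_P$, $d(Q)+b(Q)\ge\xi_Q$, $\ell'\le d+b\le u'$. Fix an arbitrarily chosen feasible solution $(\widetilde d,\widetilde b)$ of $\mathrm{DR}'$. For a positive integer $\lambda$, $\mathrm{DR}'(\lambda)$ is the problem $\mathrm{DR}'$ with the additional constraints $d(i)\equiv\widetilde d(i)$ and $b(i)\equiv\widetilde b(i)\pmod\lambda$ for all $i\in N$. *)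

theory Defs
  imports Complex_Main "HOL-Number_Theory.Cong"
begin

text \<open>
  A vector indexed by \<open>N = {1..n}\<close> is a function \<open>nat \<Rightarrow> int\<close>; only its values on \<open>{1..n}\<close> matter.
  Solutions are pairs \<open>(d, b)\<close>, and \<open>y(X)\<close> is \<open>sum y X\<close>.
\<close>

type_synonym ivec = "nat \<Rightarrow> int"

text \<open>The domain is the nonnegative quadrant; values at negative arguments are unconstrained.\<close>

definition multimodular :: "(int \<Rightarrow> int \<Rightarrow> real) \<Rightarrow> bool" where
  "multimodular f \<longleftrightarrow>
     (\<forall>\<alpha>\<ge>0. \<forall>\<beta>\<ge>0. f (\<alpha> + 1) (\<beta> + 1) - f (\<alpha> + 1) \<beta> \<ge> f \<alpha> (\<beta> + 1) - f \<alpha> \<beta>) \<and>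
     (\<forall>\<alpha>\<ge>1. \<forall>\<beta>\<ge>1. f (\<alpha> - 1) (\<beta> + 1) - f (\<alpha> - 1) \<beta> \<ge> f \<alpha> \<beta> - f \<alpha> (\<beta> - 1)) \<and>
     (\<forall>\<alpha>\<ge>1. \<forall>\<beta>\<ge>1. f (\<alpha> + 1) (\<beta> - 1) - f \<alpha> (\<beta> - 1) \<ge> f \<alpha> \<beta> - f (\<alpha> - 1) \<beta>)"

definition total_cost :: "nat \<Rightarrow> (nat \<Rightarrow> int \<Rightarrow> int \<Rightarrow> real) \<Rightarrow> ivec \<times> ivec \<Rightarrow> real" where
  "total_cost n c = (\<lambda>(d, b). \<Sum>i\<in>{1..n}. c i (d i) (b i))"

definition dock_dist :: "nat \<Rightarrow> ivec \<times> ivec \<Rightarrow> ivec \<times> ivec \<Rightarrow> int" where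
  "dock_dist n = (\<lambda>(d, b) (d', b'). \<Sum>i\<in>{1..n}. \<bar>(d i + b i) - (d' i + b' i)\<bar>)"

text \<open>Feasibility for DR without the \<open>\<ell>\<^sub>1\<close>-distance constraint, with \<open>D = sum d0 {1..n}\<close> and
  \<open>B = sum b0 {1..n}\<close>.\<close>

definition relaxed_feasible ::
  "nat \<Rightarrow> ivec \<times> ivec \<Rightarrow> ivec \<Rightarrow> ivec \<Rightarrow> ivec \<times> ivec \<Rightarrow> bool" where
  "relaxed_feasible n = (\<lambda>(d0, b0) l u (d, b).
     (\<forall>i\<in>{1..n}. 0 \<le> d i \<and> 0 \<le> b i) \<and>
     sum d {1..n} + sum b {1..n} = sum d0 {1..n} + sum b0 {1..n} \<and>
     sum b {1..n} \<le> sum b0 {1..n} \<and>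
     (\<forall>i\<in>{1..n}. l i \<le> d i + b i \<and> d i + b i \<le> u i))"

definition surplus_set :: "nat \<Rightarrow> ivec \<times> ivec \<Rightarrow> ivec \<times> ivec \<Rightarrow> nat set" where
  "surplus_set n = (\<lambda>(d0, b0) (d, b). {i \<in> {1..n}. d i + b i > d0 i + b0 i})"

text \<open>Feasibility for DR', where \<open>P\<close> is the surplus set of the chosen optimum of the relaxation.\<close>

definition DR'_feasible ::
  "nat \<Rightarrow> ivec \<times> ivec \<Rightarrow> int \<Rightarrow> ivec \<Rightarrow> ivec \<Rightarrow> nat set \<Rightarrow> ivec \<times> ivec \<Rightarrow> bool" where
  "DR'_feasible n = (\<lambda>(d0, b0) \<gamma> l u P (d, b).
     let Q = {1..n} - P;
         \<xi>\<^sub>P = sum d0 P + sum b0 P + \<gamma>;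
         \<xi>\<^sub>Q = sum d0 Q + sum b0 Q - \<gamma>;
         l' = (\<lambda>i. if i \<in> P then max (l i) (d0 i + b0 i) else l i);
         u' = (\<lambda>i. if i \<in> P then u i else min (u i) (d0 i + b0 i))
     in relaxed_feasible n (d0, b0) l' u' (d, b) \<and>
        sum d P + sum b P \<le> \<xi>\<^sub>P \<and>
        sum d Q + sum b Q \<ge> \<xi>\<^sub>Q)"

definition cong_solution :: "nat \<Rightarrow> int \<Rightarrow> ivec \<times> ivec \<Rightarrow> ivec \<times> ivec \<Rightarrow> bool" where
  "cong_solution n m = (\<lambda>(d, b) (d', b').
     \<forall>i\<in>{1..n}. [d i = d' i] (mod m) \<and> [b i = b' i] (mod m))"

end

theory Submission
  imports Defs "HOL-Library.FuncSet"
begin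

text \<open>
  Let \<open>x = (d, b)\<close> be the optimum on the sublattice of step \<open>m\<close>, and among the optima of the full
  problem let \<open>y = (d', b')\<close> be one that minimises the coordinatewise \<open>\<ell>\<^sub>1\<close>-distance to \<open>x\<close>. Suppose
  that \<open>v\<close> is a nonzero vector of multiples of \<open>m\<close> such that \<open>x + v\<close> and \<open>y - v\<close> are feasible,
  \<open>c (x + v) + c (y - v) \<le> c x + c y\<close>, and \<open>y - v\<close> is closer to \<open>x\<close> than \<open>y\<close>. Optimality of \<open>x\<close>
  gives \<open>c x \<le> c (x + v)\<close>, so \<open>y - v\<close> is again optimal, against the choice of \<open>y\<close>. Hence no such
  \<open>v\<close> exists, and the distance is bounded by showing that \<open>v\<close> can be found whenever it is large.

  The search for \<open>v\<close> is a search for a directed cycle. At station \<open>i\<close> let \<open>p = d' i - d i\<close> and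
  \<open>q = b' i - b i\<close>, and regard \<open>p\<close>, \<open>q\<close>, \<open>- (p + q)\<close> as supplies at three nodes: docks, bikes and the
  group (\<open>P\<close> or its complement) of the station. Passing \<open>m\<close> units from a node with supply at least
  \<open>m\<close> to a node with supply at most \<open>- m\<close> changes one station only, keeps it between \<open>x\<close> and \<open>y\<close>,
  and by multimodularity does not raise \<open>c i\<close> at \<open>x\<close> plus \<open>c i\<close> at \<open>y\<close>
  (\<open>transfer_exchange\<close>). The constraints that couple the stations bound the total number of bikes and
  the total over \<open>P\<close>; two further carriers of supply, one between bikes and docks and one between the
  two groups, absorb the differences of these totals, so that over all carriers the supplies sum to
  zero at each of the four nodes. A directed cycle of such transfers therefore gives a \<open>v\<close> that
  meets the coupling constraints (\<open>transfers_move_closer\<close>).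

  If there is no directed cycle, the four nodes can be ranked by \<open>0, 1, 2, 3\<close> so that all possible
  transfers go upwards (\<open>transfers_or_ranking\<close>). Because the supplies balance at every node, the sum of
  supply times rank over all carriers and nodes vanishes. Each station contributes at least
  \<open>\<bar>p + q\<bar> - 7 (m - 1)\<close> to the negative of this sum and the two additional carriers at least
  \<open>- 3 (m - 1)\<close> each, so that \<open>\<Sum>i. \<bar>p i + q i\<bar> \<le> (m - 1) (7 n + 6)\<close> (\<open>ranking_bound\<close>). This is below
  \<open>10 m n\<close> for \<open>n \<ge> 2\<close>. For \<open>n = 1\<close> the distance is zero, since the total is prescribed.
\<close>

section \<open>Exchange inequalities for multimodular functions\<close>

lemma multimodular_swap:
  assumes "multimodular f"
  shows "multimodular (\<lambda>\<alpha> \<beta>. f \<beta> \<alpha>)"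
  using assms unfolding multimodular_def by (smt (verit))

text \<open>
The first defining inequality makes the forward difference in \<open>\<alpha>\<close> grow along \<open>(0, 1)\<close>, the third
makes it grow along \<open>(1, -1)\<close>. The hypotheses say that \<open>(\<alpha>', \<beta>') - (\<alpha>, \<beta>)\<close> lies in the cone
generated by these two directions; the path chosen in the proof stays in the quadrant.
\<close>

lemma first_difference_mono:
  assumes f: "multimodular f" and "0 \<le> \<alpha>" "0 \<le> \<beta>" "0 \<le> \<beta>'" "\<alpha> \<le> \<alpha>'" "\<alpha> + \<beta> \<le> \<alpha>' + \<beta>'"
  shows "f (\<alpha> + 1) \<beta> - f \<alpha> \<beta> \<le> f (\<alpha>' + 1) \<beta>' - f \<alpha>' \<beta>'"
proof -
  define D where "D = (\<lambda>\<alpha> \<beta>. f (\<alpha> + 1) \<beta> - f \<alpha> \<beta>)"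
  have up: "D \<alpha> \<beta> \<le> D \<alpha> (\<beta> + 1)" if "0 \<le> \<alpha>" "0 \<le> \<beta>" for \<alpha> \<beta>
    using f that unfolding multimodular_def D_def by (smt (verit))
  have diag: "D \<alpha> \<beta> \<le> D (\<alpha> + 1) (\<beta> - 1)" if "0 \<le> \<alpha>" "1 \<le> \<beta>" for \<alpha> \<beta>
  proof -
    have "1 \<le> \<alpha> + 1" using that by simp
    then have "f (\<alpha> + 1 + 1) (\<beta> - 1) - f (\<alpha> + 1) (\<beta> - 1) \<ge> f (\<alpha> + 1) \<beta> - f (\<alpha> + 1 - 1) \<beta>"
      using f that unfolding multimodular_def by blast
    then show ?thesis by (simp add: D_def)
  qed
  have up_n: "D \<alpha> \<beta> \<le> D \<alpha> (\<beta> + int k)" if "0 \<le> \<alpha>" "0 \<le> \<beta>" for \<alpha> \<beta> k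
  proof (induction k)
    case (Suc k)
    have "D \<alpha> (\<beta> + int k) \<le> D \<alpha> (\<beta> + int k + 1)" by (rule up) (use that in auto)
    then show ?case using Suc by (simp add: algebra_simps)
  qed simp
  have right_n: "D \<alpha> \<beta> \<le> D (\<alpha> + int k) \<beta>" if "0 \<le> \<alpha>" "0 \<le> \<beta>" for \<alpha> \<beta> k
  proof (induction k)
    case (Suc k)
    have "D (\<alpha> + int k) \<beta> \<le> D (\<alpha> + int k) (\<beta> + 1)" by (rule up) (use that in auto)
    also have "\<dots> \<le> D (\<alpha> + int k + 1) (\<beta> + 1 - 1)" by (rule diag) (use that in auto)
    finally show ?case using Suc by (simp add: algebra_simps)
  qed simp
  have diag_n: "D \<alpha> \<beta> \<le> D (\<alpha> + int k) (\<beta> - int k)" if "0 \<le> \<alpha>" "int k \<le> \<beta>" for \<alpha> \<beta> k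
    using that
  proof (induction k)
    case (Suc k)
    have "D (\<alpha> + int k) (\<beta> - int k) \<le> D (\<alpha> + int k + 1) (\<beta> - int k - 1)"
      by (rule diag) (use Suc.prems in auto)
    then show ?case using Suc by (simp add: algebra_simps)
  qed simp
  have "D \<alpha> \<beta> \<le> D \<alpha>' \<beta>'"
  proof (cases "\<beta> \<le> \<beta>'")
    case True
    have "D \<alpha> \<beta> \<le> D (\<alpha> + int (nat (\<alpha>' - \<alpha>))) \<beta>" by (rule right_n) (use assms in auto)
    also have "\<dots> = D \<alpha>' \<beta>" using assms by simp
    also have "\<dots> \<le> D \<alpha>' (\<beta> + int (nat (\<beta>' - \<beta>)))" by (rule up_n) (use assms in auto)
    finally show ?thesis using True by simp
  next
    case False
    have "D \<alpha> \<beta> \<le> D (\<alpha> + int (nat (\<beta> - \<beta>'))) (\<beta> - int (nat (\<beta> - \<beta>')))"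
      by (rule diag_n) (use assms False in auto)
    also have "\<dots> = D (\<alpha> + (\<beta> - \<beta>')) \<beta>'" using False by simp
    also have "\<dots> \<le> D (\<alpha> + (\<beta> - \<beta>') + int (nat (\<alpha>' - (\<alpha> + (\<beta> - \<beta>'))))) \<beta>'"
      by (rule right_n) (use assms False in auto)
    finally show ?thesis using assms by simp
  qed
  then show ?thesis by (simp add: D_def)
qed

text \<open>
Here the cone is generated by \<open>(1, 0)\<close> and \<open>(0, -1)\<close>; the two generators are the third and the
second defining inequality, rearranged.
\<close>

lemma diagonal_difference_mono:
  assumes f: "multimodular f" and "0 \<le> \<alpha>" "\<alpha> \<le> \<alpha>'" "1 \<le> \<beta>'" "\<beta>' \<le> \<beta>"
  shows "f (\<alpha> + 1) (\<beta> - 1) - f \<alpha> \<beta> \<le> f (\<alpha>' + 1) (\<beta>' - 1) - f \<alpha>' \<beta>'"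
proof -
  define D where "D = (\<lambda>\<alpha> \<beta>. f (\<alpha> + 1) (\<beta> - 1) - f \<alpha> \<beta>)"
  have right: "D \<alpha> \<beta> \<le> D (\<alpha> + 1) \<beta>" if "0 \<le> \<alpha>" "1 \<le> \<beta>" for \<alpha> \<beta>
  proof -
    have "1 \<le> \<alpha> + 1" using that by simp
    then have "f (\<alpha> + 1 + 1) (\<beta> - 1) - f (\<alpha> + 1) (\<beta> - 1) \<ge> f (\<alpha> + 1) \<beta> - f (\<alpha> + 1 - 1) \<beta>"
      using f that unfolding multimodular_def by blast
    then show ?thesis by (simp add: D_def)
  qed
  have down: "D \<alpha> (\<beta> + 1) \<le> D \<alpha> \<beta>" if "0 \<le> \<alpha>" "1 \<le> \<beta>" for \<alpha> \<beta>
  proof -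
    have "1 \<le> \<alpha> + 1" using that by simp
    then have "f (\<alpha> + 1 - 1) (\<beta> + 1) - f (\<alpha> + 1 - 1) \<beta> \<ge> f (\<alpha> + 1) \<beta> - f (\<alpha> + 1) (\<beta> - 1)"
      using f that unfolding multimodular_def by blast
    then show ?thesis by (simp add: D_def)
  qed
  have right_n: "D \<alpha> \<beta> \<le> D (\<alpha> + int k) \<beta>" if "0 \<le> \<alpha>" "1 \<le> \<beta>" for \<alpha> \<beta> k
  proof (induction k)
    case (Suc k)
    have "D (\<alpha> + int k) \<beta> \<le> D (\<alpha> + int k + 1) \<beta>" by (rule right) (use that in auto)
    then show ?case using Suc by (simp add: algebra_simps)
  qed simp
  have down_n: "D \<alpha> (\<beta> + int k) \<le> D \<alpha> \<beta>" if "0 \<le> \<alpha>" "1 \<le> \<beta>" for \<alpha> \<beta> k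
  proof (induction k)
    case (Suc k)
    have "D \<alpha> (\<beta> + int k + 1) \<le> D \<alpha> (\<beta> + int k)" by (rule down) (use that in auto)
    then show ?case using Suc by (simp add: algebra_simps)
  qed simp
  have "D \<alpha> \<beta> = D \<alpha> (\<beta>' + int (nat (\<beta> - \<beta>')))" using assms by simp
  also have "\<dots> \<le> D \<alpha> \<beta>'" by (rule down_n) (use assms in auto)
  also have "\<dots> \<le> D (\<alpha> + int (nat (\<alpha>' - \<alpha>))) \<beta>'" by (rule right_n) (use assms in auto)
  finally have "D \<alpha> \<beta> \<le> D \<alpha>' \<beta>'" using assms by simp
  then show ?thesis by (simp add: D_def)
qed

lemma first_increment_mono:
  assumes f: "multimodular f" and "0 \<le> \<alpha>" "0 \<le> \<beta>" "0 \<le> \<beta>'" "\<alpha> \<le> \<alpha>'" "\<alpha> + \<beta> \<le> \<alpha>' + \<beta>'"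
  shows "f (\<alpha> + int k) \<beta> - f \<alpha> \<beta> \<le> f (\<alpha>' + int k) \<beta>' - f \<alpha>' \<beta>'"
proof (induction k)
  case (Suc k)
  have "f (\<alpha> + int k + 1) \<beta> - f (\<alpha> + int k) \<beta> \<le> f (\<alpha>' + int k + 1) \<beta>' - f (\<alpha>' + int k) \<beta>'"
    by (rule first_difference_mono[OF f]) (use assms in auto)
  then show ?case using Suc by (simp add: algebra_simps)
qed simp

lemma diagonal_increment_mono:
  assumes f: "multimodular f" and "0 \<le> \<alpha>" "\<alpha> \<le> \<alpha>'" "int k \<le> \<beta>'" "\<beta>' \<le> \<beta>"
  shows "f (\<alpha> + int k) (\<beta> - int k) - f \<alpha> \<beta> \<le> f (\<alpha>' + int k) (\<beta>' - int k) - f \<alpha>' \<beta>'"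
  using assms(4)
proof (induction k)
  case (Suc k)
  have "f (\<alpha> + int k + 1) (\<beta> - int k - 1) - f (\<alpha> + int k) (\<beta> - int k)
      \<le> f (\<alpha>' + int k + 1) (\<beta>' - int k - 1) - f (\<alpha>' + int k) (\<beta>' - int k)"
    by (rule diagonal_difference_mono[OF f]) (use assms Suc.prems in auto)
  then show ?case using Suc by (simp add: algebra_simps)
qed simp

text \<open>
The point \<open>(d' - m, b')\<close> is still ahead of \<open>(d, b)\<close> in the cone of \<open>first_difference_mono\<close>, so the last
\<open>m\<close> steps in direction \<open>(1, 0)\<close> before \<open>(d', b')\<close> cost at least as much as the first \<open>m\<close> after
\<open>(d, b)\<close>.
\<close>

lemma first_exchange:
  assumes "multimodular f" and "0 \<le> d" "0 \<le> b" "0 \<le> b'" "0 \<le> m"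
    and "m \<le> d' - d" "m \<le> (d' - d) + (b' - b)"
  shows "f (d + m) b + f (d' - m) b' \<le> f d b + f d' b'"
  using first_increment_mono[of f d b b' "d' - m" "nat m"] assms by simp

lemma diagonal_exchange:
  assumes "multimodular f" and "0 \<le> d" "0 \<le> b'" "0 \<le> m"
    and "m \<le> d' - d" "m \<le> b - b'"
  shows "f (d + m) (b - m) + f (d' - m) (b' + m) \<le> f d b + f d' b'"
  using diagonal_increment_mono[of f d "d' - m" "nat m" "b' + m" b] assms by simp

section \<open>Transfers and directed cycles\<close>

text \<open>
\<open>Surplus\<close> and \<open>Deficit\<close> are the group \<open>P\<close> and its complement. Treating the groups on a par with the
two coordinates makes each of the six elementary moves of a station (a dock or a bike more or
fewer, or one exchanged for the other) a directed edge between two nodes.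
\<close>

datatype node = Docks | Bikes | Surplus | Deficit

lemma UNIV_node: "UNIV = {Docks, Bikes, Surplus, Deficit}"
  by (auto intro: node.exhaust)

lemma finite_node: "finite (UNIV :: node set)"
  by (simp add: UNIV_node)

text \<open>
When at most three nodes have nonzero supply and the supplies sum to zero, the flow from the sources
to the sinks is unique, and the two capacity conditions say that it uses the edge from \<open>s\<close> to \<open>w\<close>
with at least \<open>m\<close> units.
\<close>

definition transfer :: "int \<Rightarrow> ('a \<Rightarrow> int) \<Rightarrow> ('a \<Rightarrow> int) \<Rightarrow> bool" where
  "transfer m a v \<longleftrightarrow> (\<forall>t. v t = 0) \<or>
     (\<exists>s w. m \<le> a s \<and> a w \<le> - m \<and> v = (\<lambda>t. m * (of_bool (t = s) - of_bool (t = w))))"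

text \<open>
The differences \<open>p\<close> in docks and \<open>q\<close> in bikes, balanced at the node \<open>g\<close> of the group. The supplies
sum to zero over the nodes, so one of the three nodes carries all of the positive or all of the
negative supply.
\<close>

definition station_supply :: "node \<Rightarrow> int \<Rightarrow> int \<Rightarrow> node \<Rightarrow> int" where
  "station_supply g p q t = of_bool (t = Docks) * p + of_bool (t = Bikes) * q - of_bool (t = g) * (p + q)"

text \<open>
Each ordered pair of distinct nodes among docks, bikes and group is one of the two exchange
inequalities, up to swapping the arguments of \<open>f\<close> and swapping the two points.
\<close>

lemma transfer_exchange:
  assumes f: "multimodular f" and m: "0 < m" and g: "g \<in> {Surplus, Deficit}"
    and nn: "0 \<le> d" "0 \<le> b" "0 \<le> d'" "0 \<le> b'"
    and v: "transfer m (station_supply g (d' - d) (b' - b)) v"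
  shows "f (d + v Docks) (b + v Bikes) + f (d' - v Docks) (b' - v Bikes) \<le> f d b + f d' b'"
proof (cases "\<forall>t. v t = 0")
  case False
  then obtain s w where sw: "m \<le> station_supply g (d' - d) (b' - b) s" "station_supply g (d' - d) (b' - b) w \<le> - m"
    and v: "v = (\<lambda>t. m * (of_bool (t = s) - of_bool (t = w)))"
    using v by (auto simp: transfer_def)
  note ex = first_exchange[OF f, of d b b' m d'] first_exchange[OF f, of d' b' b m d]
    first_exchange[OF multimodular_swap[OF f], of b d d' m b']
    first_exchange[OF multimodular_swap[OF f], of b' d' d m b]
    diagonal_exchange[OF f, of d b' m d' b] diagonal_exchange[OF f, of d' b m d b']
  show ?thesis
    using sw g m nn ex unfolding v
    by (cases s; cases w) (auto simp: station_supply_def)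
qed simp

lemma transfer_between:
  assumes "transfer m a v" "0 < m"
  shows "min 0 (a t) \<le> v t" "v t \<le> max 0 (a t)"
  using assms by (auto simp: transfer_def split: if_splits)

lemma transfer_dvd:
  assumes "transfer m a v"
  shows "m dvd v t"
proof (cases "\<forall>t. v t = 0")
  case False
  then obtain s w where "v = (\<lambda>t. m * (of_bool (t = s) - of_bool (t = w)))"
    using assms by (auto simp: transfer_def)
  then show ?thesis by simp
qed simp

text \<open>
A node without successors can take the highest rank, and induction treats the other nodes. If
every node has a successor, a smallest nonempty set \<open>S\<close> with this property is needed: following chosen
successors maps \<open>S\<close> to a set with the same property, hence onto \<open>S\<close>, so the successor function
permutes \<open>S\<close> and its edges form disjoint directed cycles.
\<close>

lemma cycle_or_ranking:
  fixes r :: "'a rel"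
  assumes "finite A"
  shows "(\<exists>S f. S \<noteq> {} \<and> S \<subseteq> A \<and> bij_betw f S S \<and> (\<forall>s\<in>S. (s, f s) \<in> r)) \<or>
    (\<exists>h. inj_on h A \<and> h ` A \<subseteq> {..<card A} \<and> (\<forall>s\<in>A. \<forall>t\<in>A. (s, t) \<in> r \<longrightarrow> h s < h t))"
  using assms
proof (induction "card A" arbitrary: A)
  case (Suc k)
  show ?case
  proof (cases "\<exists>s\<in>A. \<forall>t\<in>A. (s, t) \<notin> r")
    case True
    then obtain s where s: "s \<in> A" "\<And>t. t \<in> A \<Longrightarrow> (s, t) \<notin> r" by blast
    have k: "k = card (A - {s})" using Suc s by simp
    from Suc.hyps(1)[OF k] Suc.prems
    consider (cycle) S f where "S \<noteq> {}" "S \<subseteq> A - {s}" "bij_betw f S S" "\<forall>s\<in>S. (s, f s) \<in> r"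
      | (rank) h where "inj_on h (A - {s})" "h ` (A - {s}) \<subseteq> {..<card (A - {s})}"
        "\<forall>x\<in>A - {s}. \<forall>t\<in>A - {s}. (x, t) \<in> r \<longrightarrow> h x < h t"
      by blast
    then show ?thesis
    proof cases
      case cycle
      then show ?thesis by blast
    next
      case rank
      define h' where "h' = h(s := k)"
      have lt: "h x < k" if "x \<in> A" "x \<noteq> s" for x using rank(2) that k by auto
      have "inj_on h' A"
        using rank(1) lt by (force simp: inj_on_def h'_def)
      moreover have "h' ` A \<subseteq> {..<card A}"
        using lt Suc.hyps(2) by (fastforce simp: h'_def)
      moreover have "\<forall>x\<in>A. \<forall>t\<in>A. (x, t) \<in> r \<longrightarrow> h' x < h' t"
        using rank(3) lt s by (auto simp: h'_def)
      ultimately show ?thesis by blast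
    qed
  next
    case False
    define good where "good S \<longleftrightarrow> S \<noteq> {} \<and> S \<subseteq> A \<and> (\<forall>s\<in>S. \<exists>t\<in>S. (s, t) \<in> r)" for S
    have "good A" using False Suc by (auto simp: good_def)
    define S where "S = arg_min card good"
    have S: "good S" "\<And>T. good T \<Longrightarrow> card S \<le> card T"
      using arg_min_nat_lemma[of good, OF \<open>good A\<close>, of card] by (auto simp: S_def)
    have fin: "finite S" using S(1) Suc.prems finite_subset by (auto simp: good_def)
    obtain f where f: "\<And>s. s \<in> S \<Longrightarrow> f s \<in> S \<and> (s, f s) \<in> r"
      using S(1) unfolding good_def by metis
    have "good (f ` S)"
      using S(1) f unfolding good_def by blast
    then have "card S \<le> card (f ` S)" by (rule S(2))
    then have "f ` S = S" using f fin by (intro card_seteq) auto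
    then have "bij_betw f S S" using fin by (simp add: bij_betw_def finite_surj_inj)
    then show ?thesis using S(1) f unfolding good_def by blast
  qed
qed simp

text \<open>
A permutation \<open>f\<close> of a set of nodes along possible transfers balances at every node. Two different
edges \<open>s \<rightarrow> f s\<close> served by the same carrier would involve four different nodes, as sources and sinks
are disjoint and \<open>f\<close> is injective; the bound on the supports excludes this, so every carrier makes at
most one transfer.
\<close>

lemma transfers_or_ranking:
  fixes a :: "'k \<Rightarrow> 'a \<Rightarrow> int"
  assumes A: "finite (UNIV :: 'a set)" and K: "finite K" and m: "0 < m"
    and supp: "\<And>k. k \<in> K \<Longrightarrow> card {t. a k t \<noteq> 0} \<le> 3"
  shows "(\<exists>v. (\<exists>k\<in>K. \<exists>t. v k t \<noteq> 0) \<and> (\<forall>k\<in>K. transfer m (a k) (v k)) \<and> (\<forall>t. (\<Sum>k\<in>K. v k t) = 0)) \<or>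
    (\<exists>h :: 'a \<Rightarrow> nat. inj h \<and> (\<forall>t. h t < card (UNIV :: 'a set)) \<and>
       (\<forall>k\<in>K. \<forall>s w. m \<le> a k s \<longrightarrow> a k w \<le> - m \<longrightarrow> h s < h w))"
proof -
  define r where "r = {(s, w). \<exists>k\<in>K. m \<le> a k s \<and> a k w \<le> - m}"
  from cycle_or_ranking[OF A, of r] show ?thesis
  proof (elim disjE exE conjE)
    fix S and f :: "'a \<Rightarrow> 'a"
    assume cycle: "S \<noteq> {}" "bij_betw f S S" "\<forall>s\<in>S. (s, f s) \<in> r"
    have finS: "finite S" by (rule finite_subset[OF subset_UNIV A])
    have "\<forall>s\<in>S. \<exists>k. k \<in> K \<and> m \<le> a k s \<and> a k (f s) \<le> - m"
      using cycle(3) by (auto simp: r_def)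
    from bchoice[OF this] obtain car
      where car: "\<And>s. s \<in> S \<Longrightarrow> car s \<in> K \<and> m \<le> a (car s) s \<and> a (car s) (f s) \<le> - m"
      by blast
    define e where "e s t = m * (of_bool (t = s) - of_bool (t = f s))" for s t :: 'a
    define v where "v k t = (\<Sum>s | s \<in> S \<and> car s = k. e s t)" for k t
    have inj: "inj_on f S" using cycle(2) by (simp add: bij_betw_def)
    have one: "s = s'" if s: "s \<in> S" "s' \<in> S" and eq: "car s = car s'" for s s'
    proof (rule ccontr)
      assume ne: "s \<noteq> s'"
      have sub: "{s, s', f s, f s'} \<subseteq> {t. a (car s) t \<noteq> 0}"
        using car[OF s(1)] car[OF s(2)] m eq by auto
      have "f s \<noteq> f s'" using inj ne s by (auto dest: inj_onD)
      moreover have "{s, s'} \<inter> {f s, f s'} = {}"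
        using car[OF s(1)] car[OF s(2)] m eq by auto
      ultimately have "card {s, s', f s, f s'} = 4" using ne by auto
      moreover have "card {s, s', f s, f s'} \<le> card {t. a (car s) t \<noteq> 0}"
        by (rule card_mono[OF finite_subset[OF subset_UNIV A] sub])
      ultimately show False using supp[of "car s"] car[OF s(1)] by linarith
    qed
    have vcar: "v (car s) = e s" if "s \<in> S" for s
    proof -
      have "{s' \<in> S. car s' = car s} = {s}" using one that by blast
      then show ?thesis by (auto simp: v_def)
    qed
    have tr: "transfer m (a k) (v k)" if "k \<in> K" for k
    proof (cases "k \<in> car ` S")
      case True
      then obtain s where s: "s \<in> S" "k = car s" by blast
      then have "v k = (\<lambda>t. m * (of_bool (t = s) - of_bool (t = f s)))"
        using vcar by (simp add: e_def fun_eq_iff)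
      then show ?thesis using car[OF s(1)] s(2) unfolding transfer_def by blast
    next
      case False
      then have "{s. s \<in> S \<and> car s = k} = {}" by blast
      then have "v k t = 0" for t unfolding v_def by (simp only: sum.empty)
      then show ?thesis by (simp add: transfer_def)
    qed
    have bal: "(\<Sum>k\<in>K. v k t) = 0" for t
    proof -
      have "(\<Sum>k\<in>K. v k t) = (\<Sum>s\<in>S. e s t)"
        unfolding v_def by (rule sum.group[OF finS K]) (use car in auto)
      also have "\<dots> = m * ((\<Sum>s\<in>S. of_bool (t = s)) - (\<Sum>s\<in>S. of_bool (t = f s)))"
        by (simp add: e_def sum_distrib_left sum_subtractf right_diff_distrib)
      also have "(\<Sum>s\<in>S. of_bool (t = f s)) = (\<Sum>s\<in>S. of_bool (t = s) :: int)"
        by (rule sum.reindex_bij_betw[OF cycle(2)])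
      finally show ?thesis by simp
    qed
    obtain s where s: "s \<in> S" using cycle(1) by blast
    have "s \<noteq> f s" using car[OF s] m by auto
    then have "v (car s) s \<noteq> 0" using vcar[OF s] m by (simp add: e_def)
    then show ?thesis using tr bal car[OF s] by blast
  next
    fix h :: "'a \<Rightarrow> nat"
    assume "inj h" "range h \<subseteq> {..<card (UNIV :: 'a set)}"
      "\<forall>s\<in>UNIV. \<forall>t\<in>UNIV. (s, t) \<in> r \<longrightarrow> h s < h t"
    then have "inj h \<and> (\<forall>t. h t < card (UNIV :: 'a set)) \<and>
       (\<forall>k\<in>K. \<forall>s w. m \<le> a k s \<longrightarrow> a k w \<le> - m \<longrightarrow> h s < h w)"
      unfolding r_def by (auto simp: image_subset_iff)
    then show ?thesis by blast
  qed
qed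

section \<open>Rankings bound the distance\<close>

text \<open>
Amounts \<open>\<beta>\<close> and \<open>\<gamma>\<close> flow from a centre of rank \<open>x\<close> to nodes of ranks \<open>y\<close> and \<open>z\<close>. Large amounts
flow upwards and contribute at least their own size. An amount below \<open>m\<close> may flow down by \<open>r\<close> ranks and
then falls short of its own size by at most \<open>(r + 1) (m - 1)\<close>. As the ranks are distinct, the two
descents are at most \<open>3\<close> and \<open>2\<close>, which gives \<open>4 + 3 = 7\<close>.
\<close>

lemma star_ranking_bound:
  fixes \<beta> \<gamma> m x y z :: int
  assumes "0 \<le> \<beta>" "0 \<le> \<gamma>" "0 < m"
    and "x \<in> {0..3}" "y \<in> {0..3}" "z \<in> {0..3}" "x \<noteq> y" "x \<noteq> z" "y \<noteq> z"
    and "m \<le> \<beta> \<Longrightarrow> x < y" "m \<le> \<gamma> \<Longrightarrow> x < z"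
  shows "\<beta> + \<gamma> - 7 * (m - 1) \<le> \<beta> * (y - x) + \<gamma> * (z - x)"
proof -
  have edge: "\<delta> - max 0 (x - w + 1) * (m - 1) \<le> \<delta> * (w - x)"
    if "0 \<le> \<delta>" "m \<le> \<delta> \<Longrightarrow> x < w" for \<delta> w
  proof (cases "x < w")
    case True
    then have "\<delta> * 1 \<le> \<delta> * (w - x)" using that(1) by (intro mult_left_mono) auto
    then show ?thesis using True by simp
  next
    case False
    then have "\<delta> * (x - w + 1) \<le> (m - 1) * (x - w + 1)"
      using that False by (intro mult_right_mono) force+
    then show ?thesis using False by (simp add: algebra_simps)
  qed
  have "max 0 (x - y + 1) + max 0 (x - z + 1) \<le> 7" using assms by auto
  then have "(max 0 (x - y + 1) + max 0 (x - z + 1)) * (m - 1) \<le> 7 * (m - 1)"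
    using assms(3) by (intro mult_right_mono) auto
  moreover have "\<beta> - max 0 (x - y + 1) * (m - 1) \<le> \<beta> * (y - x)"
    by (rule edge) (use assms in auto)
  moreover have "\<gamma> - max 0 (x - z + 1) * (m - 1) \<le> \<gamma> * (z - x)"
    by (rule edge) (use assms in auto)
  ultimately show ?thesis by (simp add: algebra_simps)
qed

text \<open>
The signs of \<open>p\<close>, \<open>q\<close> and \<open>p + q\<close> decide which of the three nodes is the centre of a star and whether
the flow leaves or enters it; entering flow becomes leaving flow when the ranks are reversed.
\<close>

lemma triangle_ranking_bound:
  fixes p q m x y z :: int
  assumes "0 < m" "x \<in> {0..3}" "y \<in> {0..3}" "z \<in> {0..3}" "x \<noteq> y" "x \<noteq> z" "y \<noteq> z"
    and "m \<le> p \<Longrightarrow> m \<le> p + q \<Longrightarrow> x < z" "m \<le> q \<Longrightarrow> m \<le> p + q \<Longrightarrow> y < z"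
    and "p \<le> - m \<Longrightarrow> p + q \<le> - m \<Longrightarrow> z < x" "q \<le> - m \<Longrightarrow> p + q \<le> - m \<Longrightarrow> z < y"
    and "m \<le> p \<Longrightarrow> q \<le> - m \<Longrightarrow> x < y" "m \<le> q \<Longrightarrow> p \<le> - m \<Longrightarrow> y < x"
  shows "\<bar>p + q\<bar> - 7 * (m - 1) \<le> p * (z - x) + q * (z - y)"
proof -
  note b = star_ranking_bound[where m = m]
  consider "0 \<le> p" "0 \<le> q" | "p \<le> 0" "q \<le> 0" | "0 \<le> p" "q \<le> 0" "0 \<le> p + q"
    | "0 \<le> p" "q \<le> 0" "p + q \<le> 0" | "p \<le> 0" "0 \<le> q" "0 \<le> p + q" | "p \<le> 0" "0 \<le> q" "p + q \<le> 0"
    by linarith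
  then show ?thesis
  proof cases
    case 1
    then show ?thesis using b[of p q "3 - z" "3 - x" "3 - y"] assms by (auto simp: algebra_simps)
  next
    case 2
    then show ?thesis using b[of "-p" "-q" z x y] assms by (auto simp: algebra_simps)
  next
    case 3
    then show ?thesis using b[of "-q" "p + q" x y z] assms by (auto simp: algebra_simps)
  next
    case 4
    then show ?thesis using b[of p "- (p + q)" "3 - y" "3 - x" "3 - z"] assms by (auto simp: algebra_simps)
  next
    case 5
    then show ?thesis using b[of "-p" "p + q" y x z] assms by (auto simp: algebra_simps)
  next
    case 6
    then show ?thesis using b[of q "- (p + q)" "3 - x" "3 - y" "3 - z"] assms by (auto simp: algebra_simps)
  qed
qed

lemma pair_ranking_bound:
  fixes \<delta> m x y :: int
  assumes "0 < m" "x \<in> {0..3}" "y \<in> {0..3}" "m \<le> \<delta> \<Longrightarrow> x < y" "\<delta> \<le> - m \<Longrightarrow> y < x"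
  shows "- (3 * (m - 1)) \<le> \<delta> * (y - x)"
proof (cases "\<bar>\<delta>\<bar> < m")
  case True
  have "\<bar>\<delta> * (y - x)\<bar> \<le> (m - 1) * 3"
    unfolding abs_mult using assms True by (intro mult_mono) auto
  then show ?thesis by linarith
next
  case False
  then have "0 \<le> \<delta> * (y - x)" using assms by (auto simp: zero_le_mult_iff abs_if split: if_splits)
  moreover have "- (3 * (m - 1)) \<le> 0" using assms(1) by simp
  ultimately show ?thesis by (rule order_trans[rotated])
qed

section \<open>Feasible solutions\<close>

text \<open>
Each constraint is a bound on a coordinate, on a station total, or on one of the coupling
totals. The lower bound for the complement of \<open>P\<close> is the upper bound for \<open>P\<close> again, since the grand
total is prescribed.
\<close>

lemma DR'_feasible_between:
  fixes P n x y
  defines "N \<equiv> {1..n}"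
  assumes P: "P \<subseteq> N"
    and x: "DR'_feasible n (d0, b0) \<gamma> l u P (d, b)" and y: "DR'_feasible n (d0, b0) \<gamma> l u P (d', b')"
    and d: "\<And>i. i \<in> N \<Longrightarrow> min (d i) (d' i) \<le> e i"
    and b: "\<And>i. i \<in> N \<Longrightarrow> min (b i) (b' i) \<le> g i"
    and s: "\<And>i. i \<in> N \<Longrightarrow> min (d i + b i) (d' i + b' i) \<le> e i + g i"
      "\<And>i. i \<in> N \<Longrightarrow> e i + g i \<le> max (d i + b i) (d' i + b' i)"
    and total: "sum e N + sum g N = sum d N + sum b N"
    and bikes: "sum g N \<le> max (sum b N) (sum b' N)"
    and surplus: "sum e P + sum g P \<le> max (sum d P + sum b P) (sum d' P + sum b' P)"
  shows "DR'_feasible n (d0, b0) \<gamma> l u P (e, g)"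
proof -
  have split: "sum f (N - P) = sum f N - sum f P" for f :: "nat \<Rightarrow> int"
    using P by (intro sum_diff) (auto simp: N_def)
  show ?thesis
    using x y total bikes surplus
    unfolding DR'_feasible_def relaxed_feasible_def Let_def split_beta fst_conv snd_conv
      N_def[symmetric] split
  proof (elim conjE, intro conjI)
    assume nn: "\<forall>i\<in>N. 0 \<le> d i \<and> 0 \<le> b i" "\<forall>i\<in>N. 0 \<le> d' i \<and> 0 \<le> b' i"
    show "\<forall>i\<in>N. 0 \<le> e i \<and> 0 \<le> g i"
      using nn d b by fastforce
  next
    let ?l = "\<lambda>i. if i \<in> P then max (l i) (d0 i + b0 i) else l i"
    let ?u = "\<lambda>i. if i \<in> P then u i else min (u i) (d0 i + b0 i)"
    assume lu: "\<forall>i\<in>N. ?l i \<le> d i + b i \<and> d i + b i \<le> ?u i"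
      "\<forall>i\<in>N. ?l i \<le> d' i + b' i \<and> d' i + b' i \<le> ?u i"
    show "\<forall>i\<in>N. ?l i \<le> e i + g i \<and> e i + g i \<le> ?u i"
    proof (intro ballI)
      fix i assume i: "i \<in> N"
      then show "?l i \<le> e i + g i \<and> e i + g i \<le> ?u i"
        using bspec[OF lu(1) i] bspec[OF lu(2) i] s[OF i] by linarith
    qed
  qed linarith+
qed

text \<open>
A nonempty feasible set is infinite, because vectors are arbitrary outside \<open>{1..n}\<close>, but the cost sees
only the restrictions to \<open>{1..n}\<close>, whose values are bounded by the grand total.
\<close>

lemma finite_costs: "finite (total_cost n c ` Collect (DR'_feasible n (d0, b0) \<gamma> l u P))"
proof -
  define N where "N = {1..n}"
  define T where "T = sum d0 N + sum b0 N"
  let ?B = "N \<rightarrow>\<^sub>E {0..T}"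
  have "total_cost n c (d, b) \<in> total_cost n c ` (?B \<times> ?B)"
    if "DR'_feasible n (d0, b0) \<gamma> l u P (d, b)" for d b
  proof -
    have nn: "\<forall>i\<in>N. 0 \<le> d i \<and> 0 \<le> b i" and T: "sum d N + sum b N = T"
      using that unfolding DR'_feasible_def relaxed_feasible_def Let_def N_def T_def by auto
    have pos: "0 \<le> sum d N" "0 \<le> sum b N" using nn by (auto intro: sum_nonneg)
    have "d i \<le> T" "b i \<le> T" if "i \<in> N" for i
      using member_le_sum[of i N d] member_le_sum[of i N b] nn that T pos by (auto simp: N_def)
    then have "(restrict d N, restrict b N) \<in> ?B \<times> ?B" using nn by auto
    moreover have "total_cost n c (restrict d N, restrict b N) = total_cost n c (d, b)"
      by (auto simp: total_cost_def N_def)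
    ultimately show ?thesis by (metis imageI)
  qed
  then have "total_cost n c ` Collect (DR'_feasible n (d0, b0) \<gamma> l u P) \<subseteq> total_cost n c ` (?B \<times> ?B)"
    by auto
  moreover have "finite (?B \<times> ?B)" by (intro finite_cartesian_product finite_PiE) (auto simp: N_def)
  ultimately show ?thesis by (meson finite_surj)
qed

lemma optimum_exists:
  assumes "DR'_feasible n (d0, b0) \<gamma> l u P x"
  shows "\<exists>y. is_arg_min (total_cost n c) (DR'_feasible n (d0, b0) \<gamma> l u P) y"
proof -
  let ?F = "Collect (DR'_feasible n (d0, b0) \<gamma> l u P)"
  have "Min (total_cost n c ` ?F) \<in> total_cost n c ` ?F"
    using assms by (intro Min_in finite_costs) blast
  then obtain y where y: "y \<in> ?F" "total_cost n c y = Min (total_cost n c ` ?F)" by force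
  have "total_cost n c y \<le> total_cost n c z" if "DR'_feasible n (d0, b0) \<gamma> l u P z" for z
    using Min_le[OF finite_costs imageI, of z] that y(2) by (metis mem_Collect_eq)
  then have "is_arg_min (total_cost n c) (DR'_feasible n (d0, b0) \<gamma> l u P) y"
    using y(1) unfolding is_arg_min_linorder by blast
  then show ?thesis ..
qed

section \<open>Carriers of the difference of two solutions\<close>

text \<open>
\<open>Group_slack\<close> and \<open>Kind_slack\<close> offset the differences of the totals over \<open>P\<close> and of the numbers of
bikes. Transfers made by a slack carrier leave all stations unchanged; they record how far the transfers
at the stations shift these totals, and their supplies cap the shift by the difference of the totals of
the two solutions.
\<close>

datatype carrier = Station nat | Group_slack | Kind_slack

definition carriers :: "nat \<Rightarrow> carrier set" where
  "carriers n = insert Group_slack (insert Kind_slack (Station ` {1..n}))"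

fun carrier_supply :: "nat \<Rightarrow> nat set \<Rightarrow> ivec \<Rightarrow> ivec \<Rightarrow> carrier \<Rightarrow> node \<Rightarrow> int" where
  "carrier_supply n P p q (Station i) =
     station_supply (if i \<in> P then Surplus else Deficit) (p i) (q i)"
| "carrier_supply n P p q Group_slack =
     (\<lambda>t. (of_bool (t = Surplus) - of_bool (t = Deficit)) * (sum p P + sum q P))"
| "carrier_supply n P p q Kind_slack =
     (\<lambda>t. (of_bool (t = Bikes) - of_bool (t = Docks)) * sum p {1..n})"

lemma finite_carriers: "finite (carriers n)"
  by (simp add: carriers_def)

lemma sum_carriers:
  "(\<Sum>k\<in>carriers n. F k) = F Group_slack + F Kind_slack + (\<Sum>i\<in>{1..n}. F (Station i) :: int)"
proof -
  have "inj_on Station {1..n}" by (simp add: inj_on_def)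
  then have "sum F (Station ` {1..n}) = (\<Sum>i\<in>{1..n}. F (Station i))"
    by (simp add: sum.reindex)
  then show ?thesis by (auto simp: carriers_def image_iff)
qed

lemma card_carrier_support: "card {t. carrier_supply n P p q k t \<noteq> 0} \<le> 3"
proof -
  have "\<exists>t. carrier_supply n P p q k t = 0"
  proof (cases k)
    case (Station i)
    then show ?thesis
      by (intro exI[of _ "if i \<in> P then Deficit else Surplus"]) (simp add: station_supply_def)
  next
    case Group_slack
    then show ?thesis by (intro exI[of _ Docks]) simp
  next
    case Kind_slack
    then show ?thesis by (intro exI[of _ Surplus]) simp
  qed
  then obtain t where t: "carrier_supply n P p q k t = 0" ..
  have "card {t. carrier_supply n P p q k t \<noteq> 0} \<le> card (UNIV - {t})"
    by (rule card_mono) (use t finite_node in auto)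
  also have "\<dots> = 3" by (cases t) (simp_all add: UNIV_node)
  finally show ?thesis .
qed

lemma transfer_sum_zero:
  assumes "transfer m a v"
  shows "v Docks + v Bikes + v Surplus + v Deficit = 0"
proof (cases "\<forall>t. v t = 0")
  case False
  then obtain s w where "v = (\<lambda>t. m * (of_bool (t = s) - of_bool (t = w)))"
    using assms by (auto simp: transfer_def)
  then show ?thesis by (cases s; cases w) simp_all
qed simp

text \<open>
Summation of the station bounds leaves, after the supplies have been collected node by node, only the
contribution of the two slack carriers, each bounded by \<open>pair_ranking_bound\<close>.
\<close>

lemma ranking_bound:
  fixes h :: "node \<Rightarrow> nat" and p q :: ivec and m :: int
  assumes P: "P \<subseteq> {1..n}" and m: "0 < m"
    and total: "sum p {1..n} + sum q {1..n} = 0"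
    and h: "inj h" "\<And>t. h t < 4"
    and edge: "\<And>k s w. k \<in> carriers n \<Longrightarrow> m \<le> carrier_supply n P p q k s \<Longrightarrow>
      carrier_supply n P p q k w \<le> - m \<Longrightarrow> h s < h w"
  shows "(\<Sum>i\<in>{1..n}. \<bar>p i + q i\<bar>) \<le> (m - 1) * (7 * int n + 6)"
proof -
  define N where "N = {1..n}"
  define H where "H t = int (h t)" for t
  define g where "g i = (if i \<in> P then Surplus else Deficit)" for i
  have H: "H t \<in> {0..3}" for t using h(2)[of t] by (simp add: H_def)
  have Hne: "H s \<noteq> H t" if "s \<noteq> t" for s t using h(1) that by (auto simp: H_def dest: injD)
  have e: "H s < H w" if "k \<in> carriers n" "m \<le> carrier_supply n P p q k s"
    "carrier_supply n P p q k w \<le> - m" for k s w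
    using edge[OF that] by (simp add: H_def)
  have station: "\<bar>p i + q i\<bar> - 7 * (m - 1) \<le> p i * (H (g i) - H Docks) + q i * (H (g i) - H Bikes)"
    if i: "i \<in> N" for i
  proof (rule triangle_ranking_bound[OF m H H H])
    have k: "Station i \<in> carriers n" using i by (simp add: carriers_def N_def)
    note ei = e[OF k]
    show "H Docks \<noteq> H Bikes" "H Docks \<noteq> H (g i)" "H Bikes \<noteq> H (g i)"
      by (auto intro!: Hne simp: g_def)
    show "H Docks < H (g i)" if "m \<le> p i" "m \<le> p i + q i"
      by (rule ei) (use that in \<open>auto simp: station_supply_def g_def\<close>)
    show "H Bikes < H (g i)" if "m \<le> q i" "m \<le> p i + q i"
      by (rule ei) (use that in \<open>auto simp: station_supply_def g_def\<close>)
    show "H (g i) < H Docks" if "p i \<le> - m" "p i + q i \<le> - m"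
      by (rule ei) (use that in \<open>auto simp: station_supply_def g_def\<close>)
    show "H (g i) < H Bikes" if "q i \<le> - m" "p i + q i \<le> - m"
      by (rule ei) (use that in \<open>auto simp: station_supply_def g_def\<close>)
    show "H Docks < H Bikes" if "m \<le> p i" "q i \<le> - m"
      by (rule ei) (use that in \<open>auto simp: station_supply_def\<close>)
    show "H Bikes < H Docks" if "m \<le> q i" "p i \<le> - m"
      by (rule ei) (use that in \<open>auto simp: station_supply_def\<close>)
  qed
  define \<delta> where "\<delta> = sum p P + sum q P"
  define \<sigma> where "\<sigma> = sum p N"
  have slack: "Group_slack \<in> carriers n" "Kind_slack \<in> carriers n" by (auto simp: carriers_def)
  have group: "- (3 * (m - 1)) \<le> \<delta> * (H Deficit - H Surplus)"
  proof (rule pair_ranking_bound[OF m H H])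
    show "H Surplus < H Deficit" if "m \<le> \<delta>"
      by (rule e[OF slack(1)]) (use that in \<open>auto simp: \<delta>_def\<close>)
    show "H Deficit < H Surplus" if "\<delta> \<le> - m"
      by (rule e[OF slack(1)]) (use that in \<open>auto simp: \<delta>_def\<close>)
  qed
  have kind: "- (3 * (m - 1)) \<le> \<sigma> * (H Docks - H Bikes)"
  proof (rule pair_ranking_bound[OF m H H])
    show "H Bikes < H Docks" if "m \<le> \<sigma>"
      by (rule e[OF slack(2)]) (use that in \<open>auto simp: \<sigma>_def N_def\<close>)
    show "H Docks < H Bikes" if "\<sigma> \<le> - m"
      by (rule e[OF slack(2)]) (use that in \<open>auto simp: \<sigma>_def N_def\<close>)
  qed
  have groups: "(\<Sum>i\<in>N. (p i + q i) * H (g i)) = \<delta> * (H Surplus - H Deficit)"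
  proof -
    have fin: "finite N" by (simp add: N_def)
    have "(\<Sum>i\<in>N. (p i + q i) * H (g i)) =
        (\<Sum>i\<in>N - P. (p i + q i) * H (g i)) + (\<Sum>i\<in>P. (p i + q i) * H (g i))"
      by (rule sum.subset_diff[OF _ fin]) (use P N_def in simp)
    also have "(\<Sum>i\<in>P. (p i + q i) * H (g i)) = \<delta> * H Surplus"
      by (simp add: g_def \<delta>_def sum_distrib_right sum.distrib[symmetric])
    also have "(\<Sum>i\<in>N - P. (p i + q i) * H (g i)) = (\<Sum>i\<in>N - P. p i + q i) * H Deficit"
      by (simp add: g_def sum_distrib_right)
    also have "(\<Sum>i\<in>N - P. p i + q i) = - \<delta>"
      using sum_diff[OF fin, of P "\<lambda>i. p i + q i"] P total
      by (simp add: N_def \<delta>_def sum.distrib)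
    finally show ?thesis by (simp add: algebra_simps)
  qed
  have "(\<Sum>i\<in>N. \<bar>p i + q i\<bar> - 7 * (m - 1))
      \<le> (\<Sum>i\<in>N. p i * (H (g i) - H Docks) + q i * (H (g i) - H Bikes))"
    by (rule sum_mono) (rule station)
  also have "\<dots> = (\<Sum>i\<in>N. (p i + q i) * H (g i)) - sum p N * H Docks - sum q N * H Bikes"
    by (simp add: sum_distrib_left sum_subtractf sum.distrib algebra_simps)
  also have "\<dots> = \<delta> * (H Surplus - H Deficit) + \<sigma> * (H Bikes - H Docks)"
  proof -
    have "sum q N = - \<sigma>" using total by (simp add: \<sigma>_def N_def)
    then show ?thesis unfolding groups by (simp add: \<sigma>_def algebra_simps)
  qed
  also have "\<dots> \<le> 6 * (m - 1)" using group kind by (simp add: algebra_simps)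
  finally show ?thesis by (simp add: sum_subtractf sum.distrib N_def algebra_simps)
qed

section \<open>Moving two solutions towards each other\<close>

text \<open>
Every transfer lies between zero and the supply of its carrier, so both new solutions lie
coordinatewise between the old ones and inherit the constraints at each station. Balance at the nodes turns
the effect on the number of bikes and on the total over \<open>P\<close> into the (negated) transfers of the slack
carriers at \<open>Bikes\<close> and their transfer at \<open>Surplus\<close>, which are between zero and the differences of these totals.
\<close>

lemma transfers_move_closer:
  fixes v :: "carrier \<Rightarrow> node \<Rightarrow> int" and d b d' b' :: ivec
  defines "e \<equiv> \<lambda>i. v (Station i) Docks" and "g \<equiv> \<lambda>i. v (Station i) Bikes"
  assumes P: "P \<subseteq> {1..n}" and m: "0 < m"
    and c: "\<forall>i\<in>{1..n}. multimodular (c i)"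
    and x: "DR'_feasible n (d0, b0) \<gamma> l u P (d, b)" and y: "DR'_feasible n (d0, b0) \<gamma> l u P (d', b')"
    and v: "\<forall>k\<in>carriers n.
        transfer m (carrier_supply n P (\<lambda>i. d' i - d i) (\<lambda>i. b' i - b i) k) (v k)"
    and bal: "\<forall>t. (\<Sum>k\<in>carriers n. v k t) = 0"
    and nonzero: "\<exists>k\<in>carriers n. \<exists>t. v k t \<noteq> 0"
  shows "DR'_feasible n (d0, b0) \<gamma> l u P (\<lambda>i. d i + e i, \<lambda>i. b i + g i)"
    and "DR'_feasible n (d0, b0) \<gamma> l u P (\<lambda>i. d' i - e i, \<lambda>i. b' i - g i)"
    and "total_cost n c (\<lambda>i. d i + e i, \<lambda>i. b i + g i) +
           total_cost n c (\<lambda>i. d' i - e i, \<lambda>i. b' i - g i)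
         \<le> total_cost n c (d, b) + total_cost n c (d', b')"
    and "(\<Sum>i\<in>{1..n}. \<bar>d' i - e i - d i\<bar> + \<bar>b' i - g i - b i\<bar>)
         < (\<Sum>i\<in>{1..n}. \<bar>d' i - d i\<bar> + \<bar>b' i - b i\<bar>)"
    and "\<forall>i\<in>{1..n}. m dvd e i \<and> m dvd g i"
proof -
  define N where "N = {1..n}"
  define p where "p = (\<lambda>i. d' i - d i)"
  define q where "q = (\<lambda>i. b' i - b i)"
  define grp where "grp i = (if i \<in> P then Surplus else Deficit)" for i
  have fin: "finite N" by (simp add: N_def)
  have total: "sum d N + sum b N = sum d' N + sum b' N"
    using x y unfolding DR'_feasible_def relaxed_feasible_def Let_def N_def by auto
  then have pq: "sum p N + sum q N = 0" by (simp add: p_def q_def sum_subtractf)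
  have nn: "0 \<le> d i" "0 \<le> b i" "0 \<le> d' i" "0 \<le> b' i" if "i \<in> N" for i
    using x y that unfolding DR'_feasible_def relaxed_feasible_def Let_def N_def by auto
  have tr: "transfer m (station_supply (grp i) (p i) (q i)) (v (Station i))" if "i \<in> N" for i
    using bspec[OF v, of "Station i"] that
    by (simp add: carriers_def N_def grp_def p_def q_def)
  have trG: "transfer m (carrier_supply n P p q Group_slack) (v Group_slack)"
    and trK: "transfer m (carrier_supply n P p q Kind_slack) (v Kind_slack)"
    using v by (auto simp: carriers_def p_def q_def)
  note G = transfer_between[OF trG m] transfer_sum_zero[OF trG]
  note K = transfer_between[OF trK m] transfer_sum_zero[OF trK]
  have G0: "v Group_slack Docks = 0" "v Group_slack Bikes = 0"
    using G(1,2)[of Docks] G(1,2)[of Bikes] by auto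
  have K0: "v Kind_slack Surplus = 0" "v Kind_slack Deficit = 0"
    using K(1,2)[of Surplus] K(1,2)[of Deficit] by auto
  have S0: "v (Station i) t = 0" if "i \<in> N" "t \<notin> {Docks, Bikes, grp i}" for i t
    using transfer_between[OF tr[OF that(1)] m, of t] that(2) by (auto simp: station_supply_def)
  have grp_e: "v (Station i) (grp i) = - (e i + g i)" if i: "i \<in> N" for i
    using transfer_sum_zero[OF tr[OF i]] S0[OF i] by (auto simp: grp_def e_def g_def)
  have e: "min 0 (p i) \<le> e i" "e i \<le> max 0 (p i)"
    and g: "min 0 (q i) \<le> g i" "g i \<le> max 0 (q i)"
    and eg: "min 0 (p i + q i) \<le> e i + g i" "e i + g i \<le> max 0 (p i + q i)" if i: "i \<in> N" for i
    using transfer_between[OF tr[OF i] m, of Docks] transfer_between[OF tr[OF i] m, of Bikes]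
      transfer_between[OF tr[OF i] m, of "grp i"] grp_e[OF i]
    by (auto simp: e_def g_def station_supply_def grp_def split: if_splits)
  have bal': "v Group_slack t + v Kind_slack t + (\<Sum>i\<in>N. v (Station i) t) = 0" for t
    using bal unfolding sum_carriers N_def by blast
  have sum_e: "sum e N = - v Kind_slack Docks"
    using bal'[of Docks] G0 by (simp add: e_def)
  have sum_g: "sum g N = - v Kind_slack Bikes"
    using bal'[of Bikes] G0 by (simp add: g_def)
  have sum_eg: "sum e N + sum g N = 0"
    using K(3) K0 sum_e sum_g by simp
  have g_bounds: "min 0 (sum q N) \<le> sum g N" "sum g N \<le> max 0 (sum q N)"
    using K(1,2)[of Bikes] pq sum_g by (auto simp: N_def)
  have P_sum: "sum e P + sum g P = v Group_slack Surplus"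
  proof -
    have "(\<Sum>i\<in>N. v (Station i) Surplus) = (\<Sum>i\<in>N. if i \<in> P then - (e i + g i) else 0)"
    proof (rule sum.cong[OF refl])
      fix i assume "i \<in> N"
      then show "v (Station i) Surplus = (if i \<in> P then - (e i + g i) else 0)"
        using grp_e[of i] S0[of i Surplus] by (auto simp: grp_def)
    qed
    also have "\<dots> = (\<Sum>i\<in>N \<inter> P. - (e i + g i))"
      by (rule sum.inter_restrict[OF fin, symmetric])
    also have "N \<inter> P = P" using P by (auto simp: N_def)
    also have "(\<Sum>i\<in>P. - (e i + g i)) = - (sum e P + sum g P)"
      by (simp only: sum_negf sum.distrib)
    finally show ?thesis using bal'[of Surplus] K0 by simp
  qed
  have P_bounds: "min 0 (sum p P + sum q P) \<le> sum e P + sum g P"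
    "sum e P + sum g P \<le> max 0 (sum p P + sum q P)"
    using G(1,2)[of Surplus] P_sum by auto
  have sums: "sum p X = sum d' X - sum d X" "sum q X = sum b' X - sum b X" for X
    by (simp_all add: p_def q_def sum_subtractf)

  show "DR'_feasible n (d0, b0) \<gamma> l u P (\<lambda>i. d i + e i, \<lambda>i. b i + g i)"
  proof (rule DR'_feasible_between[OF P x y]; (unfold N_def[symmetric])?)
    fix i assume i: "i \<in> N"
    show "min (d i) (d' i) \<le> d i + e i" using e[OF i] by (auto simp: p_def)
    show "min (b i) (b' i) \<le> b i + g i" using g[OF i] by (auto simp: q_def)
    show "min (d i + b i) (d' i + b' i) \<le> d i + e i + (b i + g i)"
      "d i + e i + (b i + g i) \<le> max (d i + b i) (d' i + b' i)"
      using eg[OF i] by (auto simp: p_def q_def)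
  next
    show "(\<Sum>i\<in>N. d i + e i) + (\<Sum>i\<in>N. b i + g i) = sum d N + sum b N"
      using sum_eg by (simp add: sum.distrib)
    show "(\<Sum>i\<in>N. b i + g i) \<le> max (sum b N) (sum b' N)"
      using g_bounds by (auto simp: sum.distrib sums)
    show "(\<Sum>i\<in>P. d i + e i) + (\<Sum>i\<in>P. b i + g i) \<le> max (sum d P + sum b P) (sum d' P + sum b' P)"
      using P_bounds by (auto simp: sum.distrib sums)
  qed
  show "DR'_feasible n (d0, b0) \<gamma> l u P (\<lambda>i. d' i - e i, \<lambda>i. b' i - g i)"
  proof (rule DR'_feasible_between[OF P x y]; (unfold N_def[symmetric])?)
    fix i assume i: "i \<in> N"
    show "min (d i) (d' i) \<le> d' i - e i" using e[OF i] by (auto simp: p_def)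
    show "min (b i) (b' i) \<le> b' i - g i" using g[OF i] by (auto simp: q_def)
    show "min (d i + b i) (d' i + b' i) \<le> d' i - e i + (b' i - g i)"
      "d' i - e i + (b' i - g i) \<le> max (d i + b i) (d' i + b' i)"
      using eg[OF i] by (auto simp: p_def q_def)
  next
    show "(\<Sum>i\<in>N. d' i - e i) + (\<Sum>i\<in>N. b' i - g i) = sum d N + sum b N"
      using sum_eg total by (simp add: sum_subtractf)
    show "(\<Sum>i\<in>N. b' i - g i) \<le> max (sum b N) (sum b' N)"
      using g_bounds by (auto simp: sum_subtractf sums)
    show "(\<Sum>i\<in>P. d' i - e i) + (\<Sum>i\<in>P. b' i - g i) \<le> max (sum d P + sum b P) (sum d' P + sum b' P)"
      using P_bounds by (auto simp: sum_subtractf sums)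
  qed

  have "c i (d i + e i) (b i + g i) + c i (d' i - e i) (b' i - g i) \<le> c i (d i) (b i) + c i (d' i) (b' i)"
    if i: "i \<in> N" for i
    unfolding e_def g_def
    by (rule transfer_exchange[OF _ m _ nn[OF i], of _ "grp i"])
      (use tr[OF i] c i in \<open>auto simp: grp_def p_def q_def N_def\<close>)
  then show "total_cost n c (\<lambda>i. d i + e i, \<lambda>i. b i + g i) +
      total_cost n c (\<lambda>i. d' i - e i, \<lambda>i. b' i - g i)
      \<le> total_cost n c (d, b) + total_cost n c (d', b')"
    unfolding total_cost_def split_beta fst_conv snd_conv sum.distrib[symmetric] N_def[symmetric]
    by (rule sum_mono)

  \<comment> \<open>A slack carrier cannot move alone, since the transfers balance at every node.\<close>
  have moves: "\<exists>i\<in>N. e i \<noteq> 0 \<or> g i \<noteq> 0"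
  proof (rule ccontr)
    assume "\<not> ?thesis"
    then have z: "\<And>i. i \<in> N \<Longrightarrow> e i = 0 \<and> g i = 0" by blast
    then have zP: "\<And>i. i \<in> P \<Longrightarrow> e i = 0 \<and> g i = 0" using P by (auto simp: N_def)
    have "v (Station i) t = 0" if "i \<in> N" for i t
      using grp_e[OF that] S0[OF that, of t] z[OF that]
      by (cases "t \<in> {Docks, Bikes, grp i}") (auto simp: e_def g_def)
    moreover have "v Kind_slack t = 0" for t
      using sum_e sum_g K0 z by (cases t) auto
    moreover have "v Group_slack t = 0" for t
      using P_sum G0 G(3) zP by (cases t) auto
    ultimately show False using nonzero by (auto simp: carriers_def N_def)
  qed
  have le: "\<bar>d' i - e i - d i\<bar> \<le> \<bar>d' i - d i\<bar>" "\<bar>b' i - g i - b i\<bar> \<le> \<bar>b' i - b i\<bar>"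
    if i: "i \<in> N" for i
    using e[OF i] g[OF i] by (auto simp: p_def q_def)
  have less: "\<bar>d' i - e i - d i\<bar> < \<bar>d' i - d i\<bar> \<or> \<bar>b' i - g i - b i\<bar> < \<bar>b' i - b i\<bar>"
    if i: "i \<in> N" "e i \<noteq> 0 \<or> g i \<noteq> 0" for i
    using e[OF i(1)] g[OF i(1)] i(2) by (auto simp: p_def q_def)
  show "(\<Sum>i\<in>{1..n}. \<bar>d' i - e i - d i\<bar> + \<bar>b' i - g i - b i\<bar>)
      < (\<Sum>i\<in>{1..n}. \<bar>d' i - d i\<bar> + \<bar>b' i - b i\<bar>)"
    unfolding N_def[symmetric]
  proof (rule sum_strict_mono_ex1[OF fin])
    show "\<forall>i\<in>N. \<bar>d' i - e i - d i\<bar> + \<bar>b' i - g i - b i\<bar> \<le> \<bar>d' i - d i\<bar> + \<bar>b' i - b i\<bar>"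
      using le by (intro ballI add_mono) auto
    show "\<exists>i\<in>N. \<bar>d' i - e i - d i\<bar> + \<bar>b' i - g i - b i\<bar> < \<bar>d' i - d i\<bar> + \<bar>b' i - b i\<bar>"
    proof -
      obtain i where i: "i \<in> N" "e i \<noteq> 0 \<or> g i \<noteq> 0" using moves by blast
      have "\<bar>d' i - e i - d i\<bar> + \<bar>b' i - g i - b i\<bar> < \<bar>d' i - d i\<bar> + \<bar>b' i - b i\<bar>"
        using le[OF i(1)] less[OF i] by linarith
      then show ?thesis using i(1) by blast
    qed
  qed
  show "\<forall>i\<in>{1..n}. m dvd e i \<and> m dvd g i"
    using transfer_dvd[OF tr] unfolding N_def[symmetric] e_def g_def by blast
qed

section \<open>Proximity\<close>

theorem theorem5:
  fixes n :: nat
    and c :: "nat \<Rightarrow> int \<Rightarrow> int \<Rightarrow> real"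
    and d_bar b_bar l u :: ivec
    and d_rel b_rel d_til b_til d b :: ivec
    and \<gamma> m :: int
    and P :: "nat set"
  assumes "n \<ge> 1"
    and "\<forall>i\<in>{1..n}. 0 \<le> d_bar i \<and> 0 \<le> b_bar i"
    and "\<gamma> > 0"
    and "\<forall>i\<in>{1..n}. multimodular (c i)"
    and "is_arg_min (dock_dist n (d_bar, b_bar))
           (is_arg_min (total_cost n c) (relaxed_feasible n (d_bar, b_bar) l u)) (d_rel, b_rel)"
    and "dock_dist n (d_rel, b_rel) (d_bar, b_bar) > 2 * \<gamma>"
    and "P = surplus_set n (d_bar, b_bar) (d_rel, b_rel)"
    and "DR'_feasible n (d_bar, b_bar) \<gamma> l u P (d_til, b_til)"
    and "m > 0"
    and "is_arg_min (total_cost n c)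
           (\<lambda>x. DR'_feasible n (d_bar, b_bar) \<gamma> l u P x \<and> cong_solution n m x (d_til, b_til)) (d, b)"
  shows "\<exists>d_opt b_opt.
           is_arg_min (total_cost n c) (DR'_feasible n (d_bar, b_bar) \<gamma> l u P) (d_opt, b_opt) \<and>
           dock_dist n (d_opt, b_opt) (d, b) < 10 * m * int n"
proof -
  define F where "F = DR'_feasible n (d_bar, b_bar) \<gamma> l u P"
  define Opt where "Opt = is_arg_min (total_cost n c) F"
  define gap where "gap = (\<lambda>(d', b'). nat (\<Sum>i\<in>{1..n}. \<bar>d' i - d i\<bar> + \<bar>b' i - b i\<bar>))"
  have P: "P \<subseteq> {1..n}" using assms(7) by (auto simp: surplus_set_def)
  have m: "0 < m" by (rule assms(9))
  have x: "F (d, b)" and x_cong: "cong_solution n m (d, b) (d_til, b_til)"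
    and x_min: "\<And>z. F z \<Longrightarrow> cong_solution n m z (d_til, b_til) \<Longrightarrow> total_cost n c (d, b) \<le> total_cost n c z"
    using assms(10) unfolding is_arg_min_linorder F_def by auto
  obtain y0 where "Opt y0" using optimum_exists x unfolding F_def Opt_def by blast
  then obtain y where y: "Opt y" "\<And>z. Opt z \<Longrightarrow> gap y \<le> gap z"
    using ex_has_least_nat[of Opt y0 gap] by blast
  obtain d' b' where y_eq: "y = (d', b')" by (cases y)
  have Fy: "F (d', b')" and y_min: "\<And>z. F z \<Longrightarrow> total_cost n c (d', b') \<le> total_cost n c z"
    using y(1) unfolding Opt_def is_arg_min_linorder y_eq by auto
  let ?p = "\<lambda>i. d' i - d i" and ?q = "\<lambda>i. b' i - b i"
  have total: "sum ?p {1..n} + sum ?q {1..n} = 0"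
    using x Fy unfolding F_def DR'_feasible_def relaxed_feasible_def Let_def
    by (auto simp: sum_subtractf)
  have dist: "dock_dist n (d', b') (d, b) = (\<Sum>i\<in>{1..n}. \<bar>?p i + ?q i\<bar>)"
    unfolding dock_dist_def by (auto intro!: sum.cong arg_cong[of _ _ abs])
  \<comment> \<open>The slack carriers would cost too much for a single station: \<open>7 n + 6 \<le> 10 n\<close> needs \<open>n \<ge> 2\<close>.\<close>
  have "dock_dist n (d', b') (d, b) < 10 * m * int n"
  proof (cases "n = 1")
    case True
    then show ?thesis using dist total m by simp
  next
    case False
    from transfers_or_ranking[where K = "carriers n" and a = "carrier_supply n P ?p ?q",
        OF finite_node finite_carriers m card_carrier_support]
    show ?thesis
    proof (elim disjE exE conjE)
      fix v
      assume v: "\<exists>k\<in>carriers n. \<exists>t. v k t \<noteq> 0"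
        "\<forall>k\<in>carriers n. transfer m (carrier_supply n P ?p ?q k) (v k)"
        "\<forall>t. (\<Sum>k\<in>carriers n. v k t) = 0"
      let ?e = "\<lambda>i. v (Station i) Docks" and ?g = "\<lambda>i. v (Station i) Bikes"
      note move = transfers_move_closer[OF P m assms(4) x[unfolded F_def] Fy[unfolded F_def] v(2,3,1),
        folded F_def]
      have "cong_solution n m (\<lambda>i. d i + ?e i, \<lambda>i. b i + ?g i) (d_til, b_til)"
      proof -
        have shift: "[s + t = s'] (mod m)" if "[s = s'] (mod m)" "m dvd t" for s s' t :: int
          using cong_add[OF that(1), of t 0] that(2) by (simp add: cong_0_iff)
        show ?thesis using x_cong move(5) by (auto simp: cong_solution_def intro: shift)
      qed
      then have "total_cost n c (d, b) \<le> total_cost n c (\<lambda>i. d i + ?e i, \<lambda>i. b i + ?g i)"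
        by (rule x_min[OF move(1)])
      then have "total_cost n c (\<lambda>i. d' i - ?e i, \<lambda>i. b' i - ?g i) \<le> total_cost n c (d', b')"
        using move(3) by linarith
      then have "Opt (\<lambda>i. d' i - ?e i, \<lambda>i. b' i - ?g i)"
        using move(2) y_min order_trans unfolding Opt_def is_arg_min_linorder by blast
      then have "gap (d', b') \<le> gap (\<lambda>i. d' i - ?e i, \<lambda>i. b' i - ?g i)"
        using y(2) y_eq by blast
      moreover have "0 \<le> (\<Sum>i\<in>{1..n}. \<bar>d' i - ?e i - d i\<bar> + \<bar>b' i - ?g i - b i\<bar>)"
        by (intro sum_nonneg) auto
      ultimately show ?thesis using move(4) by (simp add: gap_def)
    next
      fix h :: "node \<Rightarrow> nat"
      assume h: "inj h" "\<forall>t. h t < card (UNIV :: node set)"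
        "\<forall>k\<in>carriers n. \<forall>s w. m \<le> carrier_supply n P ?p ?q k s \<longrightarrow>
           carrier_supply n P ?p ?q k w \<le> - m \<longrightarrow> h s < h w"
      have "card (UNIV :: node set) = 4" by (simp add: UNIV_node)
      then have "(\<Sum>i\<in>{1..n}. \<bar>?p i + ?q i\<bar>) \<le> (m - 1) * (7 * int n + 6)"
        using h by (intro ranking_bound[OF P m total h(1)]) auto
      also have "\<dots> \<le> (m - 1) * (10 * int n)"
        using assms(1) False m by (intro mult_left_mono) auto
      also have "\<dots> < 10 * m * int n"
        using assms(1) by (simp add: algebra_simps)
      finally show ?thesis unfolding dist .
    qed
  qed
  then show ?thesis using y(1) unfolding y_eq Opt_def F_def by blast
qed

end
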